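(* Let $n\ge2$ and let $p\in(1,\infty]$ and $q\in[1,\infty)$ satisfy $\frac1p+\frac1q=1$. Let $K\subset\mathbb{R}^n$ be a convex body with $0\in K$. If $K$ has a center of symmetry, then $$\operatorname{vol}_n\big(K+_p(-K)\big)\le\sum_{k=0}^n\binom{n}{k}\binom{n/q}{k/q}^{-1}\operatorname{vol}_n(K).$$
   Context: A convex body is a non-empty compact convex subset of $\mathbb{R}^n$. $-K=\{-x:x\in K\}$, and $\operatorname{vol}_n$ is Lebesgue measure. $K$ has a center of symmetry if $-K=K+x$ for some $x\in\mathbb{R}^n$ (the center need not be the origin). The support function is $h_K(u)=\sup_{x\in K}\langle x,u\rangle$. For convex bodies $K,L$ containing the origin and $p\in[1,\infty)$, the $L_p$-Minkowski sum $K+_pL$ is the convex body with support function $h_{K+_pL}=(h_K^p+h_L^p)^{1/p}$; for $p=\infty$, $K+_\infty L=\operatorname{conv}(K\cup L)$. The convention $1/\infty=0$ is used, so $q=1$ when $p=\infty$. For real $0\le y\le x$, $\binom{x}{y}:=\frac{\Gamma(x+1)}{\Gamma(y+1)\Gamma(x-y+1)}$. *)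

theory Defs
  imports "HOL-Analysis.Analysis"
begin

definition convex_body :: "'a::euclidean_space set \<Rightarrow> bool" where
  "convex_body K \<longleftrightarrow> K \<noteq> {} \<and> compact K \<and> convex K"

definition has_center_of_symmetry :: "'a::euclidean_space set \<Rightarrow> bool" where
  "has_center_of_symmetry K \<longleftrightarrow> (\<exists>x. uminus ` K = (\<lambda>y. y + x) ` K)"

definition support_fun :: "'a::euclidean_space set \<Rightarrow> 'a \<Rightarrow> real" where
  "support_fun K u = (SUP x\<in>K. x \<bullet> u)"

text \<open>For finite \<open>p\<close> the sum is described, not constructed; the description determines a
  unique convex body whenever \<open>1 < p\<close> and both summands are convex bodies containing the
  origin, see \<open>convex_body_Lp_sum\<close> and \<open>support_fun_Lp_sum\<close> below. The support functions
  occurring as bases of \<open>powr\<close> are then nonnegative.\<close>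

definition Lp_sum :: "ereal \<Rightarrow> 'a::euclidean_space set \<Rightarrow> 'a set \<Rightarrow> 'a set" where
  "Lp_sum p K L =
     (if p = \<infinity> then convex hull (K \<union> L)
      else THE M. convex_body M \<and>
             (\<forall>u. support_fun M u =
                (support_fun K u powr real_of_ereal p + support_fun L u powr real_of_ereal p)
                  powr (1 / real_of_ereal p)))"

text \<open>Binomial coefficient with two real arguments; only meaningful for \<open>0 \<le> y \<le> x\<close>.
  The library's \<open>gchoose\<close> requires the lower argument to be a natural number.\<close>

definition real_binomial :: "real \<Rightarrow> real \<Rightarrow> real" where
  "real_binomial x y = Gamma (x + 1) / (Gamma (y + 1) * Gamma (x - y + 1))"

lemma support_fun_upper:
  assumes "convex_body K" "x \<in> K"
  shows "x \<bullet> u \<le> support_fun K u"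
proof -
  have "compact ((\<lambda>x. x \<bullet> u) ` K)"
    using assms by (intro compact_continuous_image continuous_intros) (auto simp: convex_body_def)
  then have "bdd_above ((\<lambda>x. x \<bullet> u) ` K)"
    by (intro bounded_imp_bdd_above compact_imp_bounded)
  then show ?thesis
    unfolding support_fun_def using assms(2) by (rule cSUP_upper2) simp
qed

lemma support_fun_attained:
  assumes "convex_body K"
  obtains x where "x \<in> K" "x \<bullet> u = support_fun K u"
proof -
  have "\<exists>x\<in>K. \<forall>y\<in>K. y \<bullet> u \<le> x \<bullet> u"
    using assms by (intro continuous_attains_sup continuous_intros) (auto simp: convex_body_def)
  then obtain x where x: "x \<in> K" "\<forall>y\<in>K. y \<bullet> u \<le> x \<bullet> u" by blast
  have "support_fun K u = x \<bullet> u"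
    unfolding support_fun_def using x by (intro cSup_eq_maximum) auto
  with x that show ?thesis by simp
qed

lemma support_fun_subset:
  assumes K: "convex_body K" and L: "convex_body L"
    and le: "\<And>u. support_fun K u \<le> support_fun L u"
  shows "K \<subseteq> L"
proof
  fix z assume z: "z \<in> K"
  show "z \<in> L"
  proof (rule ccontr)
    assume "z \<notin> L"
    moreover have "convex L" "closed L"
      using L by (auto simp: convex_body_def compact_imp_closed)
    ultimately obtain a b where ab: "a \<bullet> z < b" "\<forall>x\<in>L. a \<bullet> x > b"
      using separating_hyperplane_closed_point by blast
    obtain x where x: "x \<in> L" "x \<bullet> (- a) = support_fun L (- a)"
      using support_fun_attained[OF L] by blast
    have "z \<bullet> (- a) \<le> x \<bullet> (- a)"
      using support_fun_upper[OF K z, of "- a"] le[of "- a"] x(2) by simp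
    with ab x(1) show False
      by (force simp: inner_commute)
  qed
qed

lemma support_fun_inject:
  assumes "convex_body K" "convex_body L" "\<And>u. support_fun K u = support_fun L u"
  shows "K = L"
  using support_fun_subset[of K L] support_fun_subset[of L K] assms by auto

lemma Lp_sum_exists:
  fixes K L :: "'a::euclidean_space set"
  assumes p: "1 < p" and K: "convex_body K" "0 \<in> K" and L: "convex_body L" "0 \<in> L"
  shows "\<exists>M. convex_body M \<and> (\<forall>u. support_fun M u =
           (support_fun K u powr p + support_fun L u powr p) powr (1 / p))"
proof -
  define q where "q = p / (p - 1)"
  have q: "q > 1" "1 / p + 1 / q = 1" "q * (p - 1) = p"
    using p by (auto simp: q_def field_simps)
  define S where "S = {(s::real, t::real). s \<ge> 0 \<and> t \<ge> 0 \<and> s powr p + t powr p \<le> 1}"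
  define C where "C = {(a::real, b::real). a \<ge> 0 \<and> b \<ge> 0} \<inter>
                      (\<Inter>w\<in>S. {c. c \<bullet> w \<le> 1})"
  have C_eq: "C = {c. c \<bullet> (-1, 0) \<le> 0} \<inter> {c. c \<bullet> (0, -1) \<le> 0} \<inter> (\<Inter>w\<in>S. {c. c \<bullet> w \<le> 1})"
    by (auto simp: C_def)
  have half: "{c. c \<bullet> w \<le> r} = {c. w \<bullet> c \<le> r}" for w :: "real \<times> real" and r
    by (simp add: inner_commute)
  have "convex C"
    unfolding C_eq half by (intro convex_Int convex_INT convex_halfspace_le)
  have "closed C"
    unfolding C_eq half by (intro closed_Int closed_INT ballI closed_halfspace_le)
  have "C \<subseteq> cbox (0, 0) (1, 1)"
  proof
    fix c assume c: "c \<in> C"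
    have "(1, 0) \<in> S" "(0, 1) \<in> S" using p by (auto simp: S_def)
    with c have "c \<bullet> (1, 0) \<le> 1" "c \<bullet> (0, 1) \<le> 1" by (auto simp: C_def)
    with c show "c \<in> cbox (0, 0) (1, 1)" by (cases c) (auto simp: C_def cbox_Pair_eq)
  qed
  then have "bounded C" using bounded_cbox bounded_subset by blast
  with \<open>closed C\<close> have "compact C" by (simp add: compact_eq_bounded_closed)
  have C00: "(0, 0) \<in> C" by (auto simp: C_def)

  define f where "f = (\<lambda>(c, x, y). fst c *\<^sub>R x + snd c *\<^sub>R (y :: 'a) :: 'a)"
  define M where "M = f ` (C \<times> K \<times> L)"
  have "compact M"
    unfolding M_def f_def split_beta
    using K L \<open>compact C\<close>
    by (intro compact_continuous_image continuous_intros compact_Times) (auto simp: convex_body_def)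
  have "M \<noteq> {}" using C00 K L by (auto simp: M_def)
  have comb: "\<exists>z\<in>A. (u * a + v * b) *\<^sub>R z = u *\<^sub>R a *\<^sub>R x + v *\<^sub>R b *\<^sub>R y"
    if A: "convex A" "x \<in> A" "y \<in> A" and nn: "u \<ge> 0" "v \<ge> 0" "a \<ge> 0" "b \<ge> 0"
    for A :: "'a set" and x y and u v a b :: real
  proof (cases "u * a + v * b = 0")
    case True
    moreover have "0 \<le> u * a" "0 \<le> v * b" using nn by auto
    ultimately have "u * a = 0" "v * b = 0" by linarith+
    then show ?thesis using A by (intro bexI[of _ x]) auto
  next
    case False
    define d where "d = u * a + v * b"
    have "0 \<le> u * a" "0 \<le> v * b" using nn by auto
    with False have d: "d > 0" by (simp add: d_def)
    define z where "z = (u * a / d) *\<^sub>R x + (v * b / d) *\<^sub>R y"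
    have "z \<in> A" unfolding z_def
      using A d nn by (intro convexD) (auto simp: d_def simp flip: add_divide_distrib)
    moreover have "d *\<^sub>R z = u *\<^sub>R a *\<^sub>R x + v *\<^sub>R b *\<^sub>R y"
      using d by (simp add: z_def scaleR_add_right)
    ultimately show ?thesis unfolding d_def by blast
  qed
  have "convex M"
  proof (rule convexI)
    fix m m' and u v :: real
    assume m: "m \<in> M" "m' \<in> M" and uv: "0 \<le> u" "0 \<le> v" "u + v = 1"
    from m(1) obtain a b x y where 1: "m = a *\<^sub>R x + b *\<^sub>R y" "(a, b) \<in> C" "x \<in> K" "y \<in> L"
      by (auto simp: M_def f_def)
    from m(2) obtain a' b' x' y' where 2: "m' = a' *\<^sub>R x' + b' *\<^sub>R y'" "(a', b') \<in> C" "x' \<in> K" "y' \<in> L"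
      by (auto simp: M_def f_def)
    have nn: "a \<ge> 0" "b \<ge> 0" "a' \<ge> 0" "b' \<ge> 0" using 1 2 by (auto simp: C_def)
    obtain z where z: "z \<in> K" "(u * a + v * a') *\<^sub>R z = u *\<^sub>R a *\<^sub>R x + v *\<^sub>R a' *\<^sub>R x'"
      using comb[of K x x' u v a a'] K 1 2 nn uv by (auto simp: convex_body_def)
    obtain w where w: "w \<in> L" "(u * b + v * b') *\<^sub>R w = u *\<^sub>R b *\<^sub>R y + v *\<^sub>R b' *\<^sub>R y'"
      using comb[of L y y' u v b b'] L 1 2 nn uv by (auto simp: convex_body_def)
    have "u *\<^sub>R (a, b) + v *\<^sub>R (a', b') \<in> C"
      using \<open>convex C\<close> 1 2 uv by (intro convexD)
    then have c: "(u * a + v * a', u * b + v * b') \<in> C" by simp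
    have "u *\<^sub>R m + v *\<^sub>R m' = f ((u * a + v * a', u * b + v * b'), z, w)"
      unfolding f_def by (simp add: z w 1 2 scaleR_add_right)
    then show "u *\<^sub>R m + v *\<^sub>R m' \<in> M"
      unfolding M_def using c z w by blast
  qed
  have M: "convex_body M"
    using \<open>compact M\<close> \<open>convex M\<close> \<open>M \<noteq> {}\<close> by (simp add: convex_body_def)
  have "support_fun M u = (support_fun K u powr p + support_fun L u powr p) powr (1 / p)" for u
  proof -
    define s t where "s = support_fun K u" and "t = support_fun L u"
    have st: "s \<ge> 0" "t \<ge> 0"
      using support_fun_upper[OF K, of u] support_fun_upper[OF L, of u] by (auto simp: s_def t_def)
    define N where "N = (s powr p + t powr p) powr (1 / p)"
    have Np: "N powr p = s powr p + t powr p"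
      using p by (simp add: N_def powr_powr)
    have N0: "N \<ge> 0" by (simp add: N_def)
    have norm1: "(s / N) powr p + (t / N) powr p = 1" if "N > 0"
    proof -
      have "(s / N) powr p + (t / N) powr p = (s powr p + t powr p) / N powr p"
        using that st by (simp add: powr_divide add_divide_distrib)
      also have "\<dots> = 1" using that unfolding Np[symmetric] by simp
      finally show ?thesis .
    qed
    have upper: "m \<bullet> u \<le> N" if "m \<in> M" for m
    proof -
      from that obtain a b x y where 1: "m = a *\<^sub>R x + b *\<^sub>R y" "(a, b) \<in> C" "x \<in> K" "y \<in> L"
        by (auto simp: M_def f_def)
      then have ab: "a \<ge> 0" "b \<ge> 0" by (auto simp: C_def)
      have "m \<bullet> u = a * (x \<bullet> u) + b * (y \<bullet> u)" by (simp add: 1 inner_add_left)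
      also have "\<dots> \<le> a * s + b * t"
        using support_fun_upper[OF K(1) 1(3), of u] support_fun_upper[OF L(1) 1(4), of u] ab
        by (intro add_mono mult_left_mono) (auto simp: s_def t_def)
      also have "\<dots> \<le> N"
      proof (cases "N = 0")
        case True
        with Np p have "s powr p + t powr p = 0" by simp
        then have "s powr p = 0" "t powr p = 0"
          using powr_ge_zero[of s p] powr_ge_zero[of t p] by linarith+
        then show ?thesis using True by simp
      next
        case False
        with N0 have N: "N > 0" by simp
        have "(s / N) powr p + (t / N) powr p = 1"
          using N by (rule norm1)
        then have "(s / N, t / N) \<in> S" using st N by (auto simp: S_def)
        then have "(a, b) \<bullet> (s / N, t / N) \<le> 1" using 1 unfolding C_def by blast
        then show ?thesis using N by (simp add: field_simps)
      qed
      finally show ?thesis .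
    qed
    have attained: "\<exists>m\<in>M. m \<bullet> u = N"
    proof (cases "N = 0")
      case True
      have "f ((0, 0), 0, 0) \<in> M" unfolding M_def using C00 K L by blast
      then show ?thesis using True by (force simp: f_def)
    next
      case False
      with N0 have N: "N > 0" by simp
      define a b where "a = (s / N) powr (p - 1)" and "b = (t / N) powr (p - 1)"
      have ab: "a \<ge> 0" "b \<ge> 0" by (auto simp: a_def b_def)
      have "a powr q + b powr q = (s / N) powr p + (t / N) powr p"
        using q by (simp add: a_def b_def powr_powr mult.commute)
      also have "\<dots> = 1"
        using N by (rule norm1)
      finally have abq: "a powr q + b powr q = 1" .
      have "(a, b) \<bullet> w \<le> 1" if "w \<in> S" for w
      proof -
        obtain s' t' where w: "w = (s', t')" by (cases w)
        have w': "s' \<ge> 0" "t' \<ge> 0" "s' powr p + t' powr p \<le> 1"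
          using that by (auto simp: S_def w)
        have "s' * a \<le> s' powr p / p + a powr q / q" "t' * b \<le> t' powr p / p + b powr q / q"
          using Youngs_inequality[of p q] p q w' ab by auto
        then have "s' * a + t' * b \<le> (s' powr p + t' powr p) / p + (a powr q + b powr q) / q"
          by (simp add: add_divide_distrib)
        also have "\<dots> \<le> 1 / p + 1 / q"
          using w' abq p q(1) by (intro add_mono divide_right_mono) auto
        finally show ?thesis using q by (simp add: w mult.commute)
      qed
      then have C: "(a, b) \<in> C" using ab by (auto simp: C_def)
      obtain x where x: "x \<in> K" "x \<bullet> u = s" using support_fun_attained[OF K(1)] s_def by metis
      obtain y where y: "y \<in> L" "y \<bullet> u = t" using support_fun_attained[OF L(1)] t_def by metis
      have pw: "r powr (p - 1) * r = r powr p" if "r \<ge> 0" for r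
        using that powr_mult_base[of r "p - 1"] by (simp add: mult.commute)
      have "f ((a, b), x, y) \<bullet> u = a * s + b * t"
        by (simp add: f_def inner_add_left x y)
      also have "\<dots> = N * (a * (s / N) + b * (t / N))"
        using N by (simp add: field_simps)
      also have "a * (s / N) + b * (t / N) = (s / N) powr p + (t / N) powr p"
        unfolding a_def b_def using st N by (simp only: pw divide_nonneg_pos)
      also have "\<dots> = 1"
        using N by (rule norm1)
      finally have "f ((a, b), x, y) \<bullet> u = N" by simp
      moreover have "f ((a, b), x, y) \<in> M" unfolding M_def using C x y by blast
      ultimately show ?thesis by blast
    qed
    have "support_fun M u = N"
      using upper attained unfolding support_fun_def by (intro cSup_eq_maximum) auto
    then show ?thesis by (simp add: N_def s_def t_def)
  qed
  with M show ?thesis by blast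
qed

lemma Lp_sum_spec:
  fixes K L :: "'a::euclidean_space set"
  assumes p: "1 < p" and K: "convex_body K" "0 \<in> K" and L: "convex_body L" "0 \<in> L"
  shows "convex_body (Lp_sum (ereal p) K L) \<and> (\<forall>u. support_fun (Lp_sum (ereal p) K L) u =
           (support_fun K u powr p + support_fun L u powr p) powr (1 / p))"
proof -
  have "\<exists>!M. convex_body M \<and> (\<forall>u. support_fun M u =
           (support_fun K u powr p + support_fun L u powr p) powr (1 / p))"
    using Lp_sum_exists[OF assms] support_fun_inject by (metis (no_types, lifting))
  from theI'[OF this] show ?thesis by (simp add: Lp_sum_def)
qed

lemma convex_body_Lp_sum:
  fixes K L :: "'a::euclidean_space set"
  assumes p: "1 < p" and K: "convex_body K" "0 \<in> K" and L: "convex_body L" "0 \<in> L"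
  shows "convex_body (Lp_sum p K L)"
proof (cases p)
  case (real r)
  with assms show ?thesis using Lp_sum_spec[of r K L] by simp
next
  case PInf
  have "compact (convex hull (K \<union> L))"
    using K L by (intro compact_convex_hull compact_Un) (auto simp: convex_body_def)
  with PInf K show ?thesis by (auto simp: Lp_sum_def convex_body_def)
qed (use p in auto)

lemma support_fun_Lp_sum:
  fixes K L :: "'a::euclidean_space set"
  assumes "1 < p" "convex_body K" "0 \<in> K" "convex_body L" "0 \<in> L"
  shows "support_fun (Lp_sum (ereal p) K L) u =
           (support_fun K u powr p + support_fun L u powr p) powr (1 / p)"
  using Lp_sum_spec[OF assms] by blast

end

theory Submission
  imports Defs
begin

text \<open>
  Let \<open>L = -K\<close>. Firey's sum is contained in the union \<open>U\<close> of the bodies \<open>a K + b L\<close> over all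
  \<open>a, b \<ge> 0\<close> with \<open>a\<^sup>q + b\<^sup>q \<le> 1\<close>: this union is convex, and by the equality case of Hoelder's
  inequality its support function is at least the \<open>p\<close>-norm of the support functions of \<open>K\<close> and
  \<open>L\<close> (\<open>Lp_sum_subset_Lq_union\<close>). So the task is to bound the volume of \<open>U\<close>.

  Write \<open>V u = u\<^bsup>1/q\<^esup> K + (1-u)\<^bsup>1/q\<^esup> L\<close> for the bodies on the curve \<open>a\<^sup>q + b\<^sup>q = 1\<close>. The heart of
  the proof is that a point deep inside \<open>U\<close> lies in many of them: if \<open>z \<in> t\<^bsup>1/q\<^esup> U\<close>, say
  \<open>z = t\<^bsup>1/q\<^esup> (a x + b y)\<close>, then \<open>z \<in> V u\<close> as soon as \<open>u \<ge> t a\<^sup>q\<close> and \<open>1 - u \<ge> t b\<^sup>q\<close>, since \<open>K\<close> and \<open>L\<close>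
  are convex and contain the origin. These \<open>u\<close> form an interval of length at least \<open>1 - t\<close>
  (\<open>interval_of_Lq_slices\<close>). That is also the measure of \<open>{s \<in> [0,1]. z \<in> s\<^bsup>1/q\<^esup> U}\<close> when \<open>t\<close> is the least
  admissible parameter, so Fubini's theorem gives
  \<open>vol U / (n/q + 1) = \<integral> vol (s\<^bsup>1/q\<^esup> U) ds \<le> \<integral> vol (V u) du\<close>, both integrals over \<open>[0,1]\<close>
  (\<open>volume_Lq_union_le_integral_slices\<close>). This step is valid for any two convex bodies containing
  the origin.

  The symmetry of \<open>K\<close> enters only now: it makes \<open>V u\<close> a translate of
  \<open>(u\<^bsup>1/q\<^esup> + (1-u)\<^bsup>1/q\<^esup>) K\<close>. Expanding the \<open>n\<close>-th power of the factor turns the integral into a sum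
  of Beta integrals, which are the inverse binomial coefficients of the bound up to the common
  factor \<open>n/q + 1\<close> (\<open>has_integral_sum_of_roots_power\<close>). For a cube with a vertex at the origin
  the bound is attained: each orthant with \<open>k\<close> positive signs contributes one inverse binomial
  coefficient.
\<close>

section \<open>Firey's sum as a union of Minkowski combinations\<close>

definition Lq_quarter_disc :: "real \<Rightarrow> (real \<times> real) set" where
  "Lq_quarter_disc q = {(a, b). 0 \<le> a \<and> 0 \<le> b \<and> a powr q + b powr q \<le> 1}"

definition Lq_union :: "real \<Rightarrow> 'a::euclidean_space set \<Rightarrow> 'a set \<Rightarrow> 'a set" where
  "Lq_union q K L = (\<lambda>((a, b), x, y). a *\<^sub>R x + b *\<^sub>R y) ` (Lq_quarter_disc q \<times> K \<times> L)"

lemma Lq_unionI: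
  "(a, b) \<in> Lq_quarter_disc q \<Longrightarrow> x \<in> K \<Longrightarrow> y \<in> L \<Longrightarrow> a *\<^sub>R x + b *\<^sub>R y \<in> Lq_union q K L"
  unfolding Lq_union_def by force

lemma Lq_unionE:
  assumes "m \<in> Lq_union q K L"
  obtains a b x y where "(a, b) \<in> Lq_quarter_disc q" "x \<in> K" "y \<in> L" "m = a *\<^sub>R x + b *\<^sub>R y"
  using assms unfolding Lq_union_def by force

text \<open>Extends \<open>powr_convex\<close> from the open to the closed half-line. When one point is \<open>0\<close> the claim
  is that \<open>w\<^sup>q \<le> w\<close> for \<open>0 \<le> w \<le> 1\<close>.\<close>

lemma powr_convex_combination:
  fixes q :: real
  assumes q: "1 \<le> q" and xy: "0 \<le> x" "0 \<le> y" and uv: "0 \<le> u" "0 \<le> v" "u + v = 1"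
  shows "(u * x + v * y) powr q \<le> u * x powr q + v * y powr q"
proof -
  have shrink: "(w * z) powr q \<le> w * z powr q" if "0 \<le> w" "w \<le> 1" "0 \<le> z" for w z :: real
  proof -
    have "w powr q \<le> w powr 1"
      using q that by (intro powr_mono') auto
    then show ?thesis
      using that by (simp add: powr_mult mult_right_mono)
  qed
  consider "x = 0" | "y = 0" | "0 < x" "0 < y" using xy by linarith
  then show ?thesis
  proof cases
    case 1
    then show ?thesis using shrink[of v y] uv xy by simp
  next
    case 2
    then show ?thesis using shrink[of u x] uv xy by simp
  next
    case 3
    then have "((1 - v) * x + v * y) powr q \<le> (1 - v) * x powr q + v * y powr q"
      using convex_onD[OF powr_convex[OF q], of v x y] uv by simp
    moreover have "1 - v = u" using uv by simp
    ultimately show ?thesis by (simp only:)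
  qed
qed

lemma convex_Lq_quarter_disc:
  assumes "1 \<le> q"
  shows "convex (Lq_quarter_disc q)"
proof (rule convexI)
  fix c c' :: "real \<times> real" and u v :: real
  assume c: "c \<in> Lq_quarter_disc q" "c' \<in> Lq_quarter_disc q" and uv: "0 \<le> u" "0 \<le> v" "u + v = 1"
  obtain a b a' b' where ab: "c = (a, b)" "c' = (a', b')" by fastforce
  have nn: "0 \<le> a" "0 \<le> b" "0 \<le> a'" "0 \<le> b'"
    and le: "a powr q + b powr q \<le> 1" "a' powr q + b' powr q \<le> 1"
    using c by (auto simp: ab Lq_quarter_disc_def)
  have "(u * a + v * a') powr q + (u * b + v * b') powr q
      \<le> (u * a powr q + v * a' powr q) + (u * b powr q + v * b' powr q)"
    using powr_convex_combination[OF assms] nn uv by (intro add_mono) auto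
  also have "\<dots> = u * (a powr q + b powr q) + v * (a' powr q + b' powr q)"
    by (simp add: algebra_simps)
  also have "\<dots> \<le> u * 1 + v * 1"
    using le uv by (intro add_mono mult_left_mono) auto
  finally show "u *\<^sub>R c + v *\<^sub>R c' \<in> Lq_quarter_disc q"
    using nn uv by (simp add: ab Lq_quarter_disc_def)
qed

lemma compact_Lq_quarter_disc:
  assumes "1 \<le> q"
  shows "compact (Lq_quarter_disc q)"
proof -
  let ?S = "cbox (0, 0) (1, 1) :: (real \<times> real) set"
  have le1: "x \<le> 1" if "x powr q \<le> 1" "0 \<le> x" for x :: real
  proof (rule ccontr)
    assume "\<not> x \<le> 1"
    then have "1 powr q < x powr q" using assms by (intro powr_less_mono2) auto
    then show False using that by simp
  qed
  have bound: "a \<le> 1 \<and> b \<le> 1" if "(a, b) \<in> Lq_quarter_disc q" for a b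
    using that le1[of a] le1[of b] powr_ge_zero[of a q] powr_ge_zero[of b q]
    by (auto simp: Lq_quarter_disc_def)
  have eq: "Lq_quarter_disc q = ?S \<inter> (\<lambda>c. fst c powr q + snd c powr q) -` {..1}"
  proof (intro set_eqI)
    fix c :: "real \<times> real"
    obtain a b where "c = (a, b)" by (cases c)
    then show "c \<in> Lq_quarter_disc q \<longleftrightarrow> c \<in> ?S \<inter> (\<lambda>c. fst c powr q + snd c powr q) -` {..1}"
      using bound[of a b] by (auto simp: Lq_quarter_disc_def cbox_Pair_eq)
  qed
  have "closed (?S \<inter> (\<lambda>c. fst c powr q + snd c powr q) -` {..1})"
    using assms
    by (intro continuous_closed_preimage continuous_on_add continuous_on_powr' continuous_on_fst
          continuous_on_snd continuous_on_id continuous_on_const closed_cbox closed_atMost)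
       (simp_all add: cbox_Pair_eq)
  moreover have "bounded (Lq_quarter_disc q)"
    unfolding eq by (intro bounded_Int disjI1 bounded_cbox)
  ultimately show ?thesis
    by (simp add: compact_eq_bounded_closed eq)
qed

text \<open>For convex \<open>A\<close> the sum \<open>a A + b A\<close> is contained in \<open>(a + b) A\<close>. Convexity of the union, the
  nesting of the multiples of a body around the origin, and the shape of the combinations of a
  symmetric body with its reflection all come down to this.\<close>

lemma convex_combine_multiples:
  assumes A: "convex A" "x \<in> A" "y \<in> A" and ab: "0 \<le> a" "0 \<le> (b::real)"
  obtains z where "z \<in> A" "(a + b) *\<^sub>R z = a *\<^sub>R x + b *\<^sub>R y"
proof (cases "a + b = 0")
  case True
  with ab have "a = 0" "b = 0" by auto
  with A that[of x] show ?thesis by simp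
next
  case False
  have "(a / (a + b)) *\<^sub>R x + (b / (a + b)) *\<^sub>R y \<in> A"
    using A ab False by (intro convexD) (auto simp flip: add_divide_distrib)
  with False that[of "(a / (a + b)) *\<^sub>R x + (b / (a + b)) *\<^sub>R y"] show ?thesis
    by (simp add: scaleR_add_right)
qed

text \<open>The coefficient pairs are averaged in the disc, and the points are averaged within \<open>K\<close> and
  within \<open>L\<close> with weights proportional to the resulting coefficients.\<close>

lemma convex_body_Lq_union:
  fixes K L :: "'a::euclidean_space set"
  assumes q: "1 \<le> q" and K: "convex_body K" and L: "convex_body L"
  shows "convex_body (Lq_union q K L)"
proof -
  have "compact (Lq_union q K L)"
    unfolding Lq_union_def split_beta using K L compact_Lq_quarter_disc[OF q]
    by (intro compact_continuous_image continuous_intros compact_Times) (auto simp: convex_body_def)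
  moreover have "(0, 0) \<in> Lq_quarter_disc q" by (simp add: Lq_quarter_disc_def)
  then have "Lq_union q K L \<noteq> {}"
    using K L unfolding convex_body_def by (metis Lq_unionI empty_iff equals0I)
  moreover have "convex (Lq_union q K L)"
  proof (rule convexI)
    fix m m' and u v :: real
    assume m: "m \<in> Lq_union q K L" "m' \<in> Lq_union q K L" and uv: "0 \<le> u" "0 \<le> v" "u + v = 1"
    obtain a b x y where 1: "(a, b) \<in> Lq_quarter_disc q" "x \<in> K" "y \<in> L" "m = a *\<^sub>R x + b *\<^sub>R y"
      using m(1) by (rule Lq_unionE)
    obtain a' b' x' y' where 2: "(a', b') \<in> Lq_quarter_disc q" "x' \<in> K" "y' \<in> L" "m' = a' *\<^sub>R x' + b' *\<^sub>R y'"
      using m(2) by (rule Lq_unionE)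
    have nn: "0 \<le> a" "0 \<le> b" "0 \<le> a'" "0 \<le> b'" using 1 2 by (auto simp: Lq_quarter_disc_def)
    obtain z where z: "z \<in> K" "(u * a + v * a') *\<^sub>R z = (u * a) *\<^sub>R x + (v * a') *\<^sub>R x'"
      using convex_combine_multiples[of K x x' "u * a" "v * a'"] K 1 2 nn uv
      by (auto simp: convex_body_def)
    obtain w where w: "w \<in> L" "(u * b + v * b') *\<^sub>R w = (u * b) *\<^sub>R y + (v * b') *\<^sub>R y'"
      using convex_combine_multiples[of L y y' "u * b" "v * b'"] L 1 2 nn uv
      by (auto simp: convex_body_def)
    have "u *\<^sub>R (a, b) + v *\<^sub>R (a', b') \<in> Lq_quarter_disc q"
      using convex_Lq_quarter_disc[OF q] 1(1) 2(1) uv by (rule convexD)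
    then have "(u * a + v * a') *\<^sub>R z + (u * b + v * b') *\<^sub>R w \<in> Lq_union q K L"
      using z w by (intro Lq_unionI) auto
    moreover have "(u * a + v * a') *\<^sub>R z + (u * b + v * b') *\<^sub>R w = u *\<^sub>R m + v *\<^sub>R m'"
      unfolding z(2) w(2) 1(4) 2(4) by (simp add: scaleR_add_right)
    ultimately show "u *\<^sub>R m + v *\<^sub>R m' \<in> Lq_union q K L" by metis
  qed
  ultimately show ?thesis by (simp add: convex_body_def)
qed

text \<open>The equality case of Hoelder's inequality: the extremal pair is proportional to
  \<open>(s\<^bsup>p-1\<^esup>, t\<^bsup>p-1\<^esup>)\<close>, and dividing by the norm \<open>N\<close> first puts it on the unit circle of the
  \<open>q\<close>-norm because \<open>(p - 1) q = p\<close>.\<close>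

lemma Lp_norm_attained_on_Lq_quarter_disc:
  fixes p q s t :: real
  assumes p: "1 < p" "1 / p + 1 / q = 1" and st: "0 \<le> s" "0 \<le> t"
  obtains a b where "(a, b) \<in> Lq_quarter_disc q" "(s powr p + t powr p) powr (1 / p) = a * s + b * t"
proof -
  have "1 / q = (p - 1) / p" using p by (simp add: field_simps)
  then have q: "(p - 1) * q = p" using p by (cases "q = 0") (auto simp: field_simps)
  define N where "N = (s powr p + t powr p) powr (1 / p)"
  have Np: "N powr p = s powr p + t powr p"
    using p by (simp add: N_def powr_powr)
  show ?thesis
  proof (cases "N = 0")
    case True
    with that[of 0 0] show ?thesis by (simp add: Lq_quarter_disc_def N_def)
  next
    case False
    then have N: "0 < N" by (simp add: N_def)
    have "(s / N) powr p + (t / N) powr p = (s powr p + t powr p) / N powr p"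
      using N st by (simp add: powr_divide add_divide_distrib)
    then have norm1: "(s / N) powr p + (t / N) powr p = 1"
      using N unfolding Np[symmetric] by simp
    define a b where "a = (s / N) powr (p - 1)" and "b = (t / N) powr (p - 1)"
    have pw: "r powr (p - 1) * r = r powr p" if "0 \<le> r" for r
      using that powr_mult_base[of r "p - 1"] by (simp add: mult.commute)
    have "(a, b) \<in> Lq_quarter_disc q"
      using norm1 by (simp add: Lq_quarter_disc_def a_def b_def powr_powr q)
    moreover have "a * (s / N) + b * (t / N) = 1"
      unfolding a_def b_def using st N norm1 by (simp only: pw divide_nonneg_pos)
    then have "N = a * s + b * t"
      using N by (simp add: field_simps)
    ultimately show ?thesis using that by (simp add: N_def)
  qed
qed

text \<open>For finite \<open>p\<close> convex bodies are compared through their support functions. For \<open>p = \<infinity>\<close> the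
  sum is a convex hull, and the extreme coefficient pairs \<open>(1, 0)\<close> and \<open>(0, 1)\<close> put \<open>K\<close> and \<open>L\<close>
  into the convex union.\<close>

lemma Lp_sum_subset_Lq_union:
  fixes K L :: "'a::euclidean_space set"
  assumes p: "1 < p" and q: "1 \<le> q" and pq: "1 / p + 1 / ereal q = 1"
    and K: "convex_body K" "0 \<in> K" and L: "convex_body L" "0 \<in> L"
  shows "Lp_sum p K L \<subseteq> Lq_union q K L"
proof (cases p)
  case (real r)
  have r: "1 < r" "1 / r + 1 / q = 1"
    using p pq q by (auto simp: real one_ereal_def split: if_splits)
  have U: "convex_body (Lq_union q K L)"
    by (rule convex_body_Lq_union) fact+
  have "support_fun (Lp_sum (ereal r) K L) u \<le> support_fun (Lq_union q K L) u" for u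
  proof -
    obtain x where x: "x \<in> K" "x \<bullet> u = support_fun K u" using support_fun_attained[OF K(1)] .
    obtain y where y: "y \<in> L" "y \<bullet> u = support_fun L u" using support_fun_attained[OF L(1)] .
    have "0 \<le> support_fun K u" "0 \<le> support_fun L u"
      using support_fun_upper[OF K, of u] support_fun_upper[OF L, of u] by auto
    then obtain a b where ab: "(a, b) \<in> Lq_quarter_disc q"
        "(support_fun K u powr r + support_fun L u powr r) powr (1 / r)
          = a * support_fun K u + b * support_fun L u"
      using Lp_norm_attained_on_Lq_quarter_disc[OF r] by blast
    have "support_fun (Lp_sum (ereal r) K L) u = (a *\<^sub>R x + b *\<^sub>R y) \<bullet> u"
      using support_fun_Lp_sum[OF r(1) K L] ab x y by (simp add: inner_add_left)
    also have "\<dots> \<le> support_fun (Lq_union q K L) u"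
      using ab x y by (intro support_fun_upper U Lq_unionI)
    finally show ?thesis .
  qed
  moreover have "convex_body (Lp_sum (ereal r) K L)"
    using r K L by (intro convex_body_Lp_sum) auto
  ultimately show ?thesis
    using support_fun_subset U unfolding real by blast
next
  case PInf
  have "(1, 0) \<in> Lq_quarter_disc q" "(0, 1) \<in> Lq_quarter_disc q" by (auto simp: Lq_quarter_disc_def)
  then have "1 *\<^sub>R x + 0 *\<^sub>R 0 \<in> Lq_union q K L" "0 *\<^sub>R 0 + 1 *\<^sub>R y \<in> Lq_union q K L"
    if "x \<in> K" "y \<in> L" for x y
    using that K L by (blast intro: Lq_unionI)+
  then have "K \<union> L \<subseteq> Lq_union q K L" using K L by auto
  moreover have "convex (Lq_union q K L)"
    using convex_body_Lq_union[OF q K(1) L(1)] by (simp add: convex_body_def)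
  ultimately show ?thesis
    by (simp add: PInf Lp_sum_def hull_minimal)
qed (use p in auto)

section \<open>A volume inequality of Rogers--Shephard type\<close>

text \<open>The boundary arc of the disc is parametrised by \<open>u = a\<^sup>q\<close>. This parameter, rather than the
  angle or \<open>a\<close> itself, makes the set of \<open>u\<close> found in \<open>interval_of_Lq_slices\<close> an interval of a
  length that depends on \<open>t\<close> alone.\<close>

definition Lq_slice :: "real \<Rightarrow> 'a::euclidean_space set \<Rightarrow> 'a set \<Rightarrow> real \<Rightarrow> 'a set" where
  "Lq_slice q K L u = (\<lambda>(x, y). u powr (1 / q) *\<^sub>R x + (1 - u) powr (1 / q) *\<^sub>R y) ` (K \<times> L)"

lemma convex_scaleR_shrink:
  assumes "convex K" "0 \<in> K" "x \<in> K" "0 \<le> s" "s \<le> (r::real)"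
  obtains x' where "x' \<in> K" "s *\<^sub>R x = r *\<^sub>R x'"
proof -
  obtain z where "z \<in> K" "(s + (r - s)) *\<^sub>R z = s *\<^sub>R x + (r - s) *\<^sub>R 0"
    using convex_combine_multiples[OF assms(1,3,2), of s "r - s"] assms by auto
  with that[of z] show ?thesis by simp
qed

text \<open>Write \<open>z = a x + b y\<close>. Shrinking a coefficient keeps the point inside the larger multiple of
  a convex set around the origin, so \<open>u\<close> is admissible when \<open>u\<^bsup>1/q\<^esup> \<ge> t\<^bsup>1/q\<^esup> a\<close> and
  \<open>(1-u)\<^bsup>1/q\<^esup> \<ge> t\<^bsup>1/q\<^esup> b\<close>, that is, for \<open>t a\<^sup>q \<le> u \<le> 1 - t b\<^sup>q\<close>; and
  \<open>1 - t b\<^sup>q \<ge> t a\<^sup>q + (1 - t)\<close> because \<open>a\<^sup>q + b\<^sup>q \<le> 1\<close>.\<close>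

lemma interval_of_Lq_slices:
  assumes q: "1 \<le> q" and K: "convex K" "0 \<in> K" and L: "convex L" "0 \<in> L"
    and z: "z \<in> Lq_union q K L" and t: "0 \<le> t" "t \<le> 1"
  obtains v where "{v..v + (1 - t)} \<subseteq> {u \<in> {0..1}. t powr (1 / q) *\<^sub>R z \<in> Lq_slice q K L u}"
proof -
  obtain a b x y where ab: "(a, b) \<in> Lq_quarter_disc q" and xy: "x \<in> K" "y \<in> L"
    and z_eq: "z = a *\<^sub>R x + b *\<^sub>R y"
    using z by (rule Lq_unionE)
  have nn: "0 \<le> a" "0 \<le> b" and le: "a powr q + b powr q \<le> 1"
    using ab by (auto simp: Lq_quarter_disc_def)
  have root: "t powr (1 / q) * c \<le> u powr (1 / q)" if "0 \<le> c" "t * c powr q \<le> u" for c u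
  proof -
    have "(t * c powr q) powr (1 / q) \<le> u powr (1 / q)"
      using that t q by (intro powr_mono2) auto
    then show ?thesis using that t q by (simp add: powr_mult powr_powr)
  qed
  have "u \<in> {0..1} \<and> t powr (1 / q) *\<^sub>R z \<in> Lq_slice q K L u"
    if u: "u \<in> {t * a powr q .. t * a powr q + (1 - t)}" for u
  proof -
    have "t * (a powr q + b powr q) \<le> t * 1" using le t by (intro mult_left_mono) auto
    then have ub: "t * b powr q \<le> 1 - u" using u by (simp add: algebra_simps)
    obtain x' where x': "x' \<in> K" "(t powr (1 / q) * a) *\<^sub>R x = u powr (1 / q) *\<^sub>R x'"
      using convex_scaleR_shrink[OF K xy(1) _ root[of a u]] nn u by auto
    obtain y' where y': "y' \<in> L" "(t powr (1 / q) * b) *\<^sub>R y = (1 - u) powr (1 / q) *\<^sub>R y'"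
      using convex_scaleR_shrink[OF L xy(2) _ root[of b "1 - u"]] nn ub by auto
    have "t powr (1 / q) *\<^sub>R z = u powr (1 / q) *\<^sub>R x' + (1 - u) powr (1 / q) *\<^sub>R y'"
      by (simp add: z_eq scaleR_add_right x' y')
    then have "t powr (1 / q) *\<^sub>R z \<in> Lq_slice q K L u"
      unfolding Lq_slice_def using x' y' by force
    moreover have "0 \<le> t * a powr q" "0 \<le> t * b powr q" using t by auto
    with u ub have "u \<in> {0..1}" by auto
    ultimately show ?thesis by blast
  qed
  then show ?thesis using that[of "t * a powr q"] by blast
qed

lemma emeasure_lborel_scaleR:
  "emeasure lborel ((*\<^sub>R) c ` S) = ennreal (\<bar>c\<bar> ^ DIM('a)) * emeasure lborel S"
  if "compact S" for S :: "'a::euclidean_space set"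
  using emeasure_lebesgue_affine[of c 0 S] that
  by (simp add: emeasure_completion borel_compact compact_scaling ennreal_power)

text \<open>The two compact sets \<open>E\<close> and \<open>F\<close> in \<open>\<real> \<times> \<real>\<^sup>n\<close> have the bodies \<open>V u\<close> (the slices) and \<open>t\<^bsup>1/q\<^esup> U\<close>, respectively,
  as sections over the first coordinate. Over a fixed point \<open>z\<close> the section of \<open>F\<close> lies in
  \<open>[t, 1]\<close> with \<open>t\<close> its least element, while that of \<open>E\<close> contains an interval of length \<open>1 - t\<close>.
  Hence \<open>F\<close> has at most the measure of \<open>E\<close>, and computing both measures in the other order of
  integration gives the claim.\<close>

lemma volume_Lq_union_le_integral_slices:
  fixes K L :: "'a::euclidean_space set"
  assumes q: "1 \<le> q" and K: "convex_body K" "0 \<in> K" and L: "convex_body L" "0 \<in> L"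
  shows "ennreal (1 / (real DIM('a) / q + 1)) * emeasure lborel (Lq_union q K L)
    \<le> (\<integral>\<^sup>+u. emeasure lborel (Lq_slice q K L u) * indicator {0..1} u \<partial>lborel)"
proof -
  let ?U = "Lq_union q K L"
  define E where "E = {(u, z). u \<in> {0..1} \<and> z \<in> Lq_slice q K L u}"
  define F where "F = {(t, z). t \<in> {0..1} \<and> z \<in> (*\<^sub>R) (t powr (1 / q)) ` ?U}"
  have cU: "compact ?U"
    using convex_body_Lq_union[OF q K(1) L(1)] by (simp add: convex_body_def)
  have cK: "compact K" "convex K" and cL: "compact L" "convex L"
    using K L by (auto simp: convex_body_def)
  have "E = (\<lambda>(u, x, y). (u, u powr (1 / q) *\<^sub>R x + (1 - u) powr (1 / q) *\<^sub>R y)) ` ({0..1} \<times> K \<times> L)"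
    by (force simp: E_def Lq_slice_def)
  also have "compact \<dots>"
    unfolding split_beta using cK cL q
    by (intro compact_continuous_image compact_Times compact_Icc continuous_on_Pair continuous_on_add
          continuous_on_scaleR continuous_on_powr' continuous_on_diff continuous_on_fst continuous_on_snd
          continuous_on_id continuous_on_const) auto
  finally have cE: "compact E" .
  have "F = (\<lambda>(t, z). (t, t powr (1 / q) *\<^sub>R z)) ` ({0..1} \<times> ?U)"
    by (force simp: F_def)
  also have "compact \<dots>"
    unfolding split_beta using cU q
    by (intro compact_continuous_image compact_Times compact_Icc continuous_on_Pair
          continuous_on_scaleR continuous_on_powr' continuous_on_fst continuous_on_snd
          continuous_on_id continuous_on_const) auto
  finally have cF: "compact F" .
  have meas: "E \<in> sets (lborel \<Otimes>\<^sub>M lborel)" "F \<in> sets (lborel \<Otimes>\<^sub>M lborel)"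
    using cE cF unfolding lborel_prod by (simp_all add: borel_compact)
  have section_le: "emeasure lborel ((\<lambda>t. (t, z)) -` F) \<le> emeasure lborel ((\<lambda>u. (u, z)) -` E)" for z
  proof (cases "(\<lambda>t. (t, z)) -` F = {}")
    case True
    then show ?thesis by simp
  next
    case False
    have "(\<lambda>t. (t, z)) -` F = fst ` (F \<inter> UNIV \<times> {z})" by force
    also have "compact \<dots>"
      using cF by (intro compact_continuous_image continuous_intros compact_Int_closed closed_Times) auto
    finally obtain t where tF: "(t, z) \<in> F" and min: "\<And>s. (s, z) \<in> F \<Longrightarrow> t \<le> s"
      using compact_attains_inf[of "(\<lambda>t. (t, z)) -` F"] False by auto
    from tF obtain w where t: "0 \<le> t" "t \<le> 1" and w: "w \<in> ?U" "z = t powr (1 / q) *\<^sub>R w"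
      by (auto simp: F_def)
    obtain v where v: "{v..v + (1 - t)} \<subseteq> {u \<in> {0..1}. t powr (1 / q) *\<^sub>R w \<in> Lq_slice q K L u}"
      using interval_of_Lq_slices[OF q cK(2) K(2) cL(2) L(2) w(1) t] .
    have "s \<le> 1" if "(s, z) \<in> F" for s using that by (simp add: F_def)
    with min have "(\<lambda>t. (t, z)) -` F \<subseteq> {t..1}" by auto
    then have "emeasure lborel ((\<lambda>t. (t, z)) -` F) \<le> emeasure lborel {t..1}"
      by (intro emeasure_mono) auto
    also have "\<dots> = emeasure lborel {v..v + (1 - t)}"
      using t by simp
    also have "\<dots> \<le> emeasure lborel ((\<lambda>u. (u, z)) -` E)"
      using v meas(1) by (intro emeasure_mono sets_Pair2) (auto simp: E_def w)
    finally show ?thesis .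
  qed
  have "((\<lambda>t::real. t powr (real DIM('a) / q)) has_integral 1 / (real DIM('a) / q + 1)) {0..1}"
    using has_integral_powr_from_0[of "real DIM('a) / q" 1] q
    by (auto simp: less_le_trans[of "-1" 0])
  then have int: "(\<integral>\<^sup>+t. ennreal (t powr (real DIM('a) / q)) * indicator {0..1} t \<partial>lborel)
      = ennreal (1 / (real DIM('a) / q + 1))"
    by (rule nn_integral_has_integral_lebesgue'[rotated]) auto
  have "ennreal (1 / (real DIM('a) / q + 1)) * emeasure lborel ?U
      = (\<integral>\<^sup>+t. ennreal (t powr (real DIM('a) / q)) * indicator {0..1} t * emeasure lborel ?U \<partial>lborel)"
    unfolding int[symmetric] by (rule nn_integral_multc[symmetric]) simp
  also have "\<dots> = (\<integral>\<^sup>+t. emeasure lborel (Pair t -` F) \<partial>lborel)"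
  proof (intro nn_integral_cong_AE AE_I[of _ _ "{0}"])
    have "ennreal (t powr (real DIM('a) / q)) * indicator {0..1} t * emeasure lborel ?U
        = emeasure lborel (Pair t -` F)" if "t \<noteq> 0" for t
    proof (cases "t \<in> {0..1}")
      case True
      with that have "0 < t" by simp
      then have "t powr (real DIM('a) / q) = \<bar>t powr (1 / q)\<bar> ^ DIM('a)"
        by (simp add: powr_powr flip: powr_realpow)
      moreover have "Pair t -` F = (*\<^sub>R) (t powr (1 / q)) ` ?U"
        using True by (auto simp: F_def)
      ultimately show ?thesis
        using True emeasure_lborel_scaleR[OF cU, of "t powr (1 / q)"] by simp
    next
      case False
      then have "Pair t -` F = {}" by (auto simp: F_def)
      with False show ?thesis by simp
    qed
    then show "{t \<in> space lborel. ennreal (t powr (real DIM('a) / q)) * indicator {0..1} t * emeasure lborel ?U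
        \<noteq> emeasure lborel (Pair t -` F)} \<subseteq> {0}" by blast
  qed auto
  also have "\<dots> = emeasure (lborel \<Otimes>\<^sub>M lborel) F"
    by (rule lborel.emeasure_pair_measure_alt[OF meas(2), symmetric])
  also have "\<dots> = (\<integral>\<^sup>+z. emeasure lborel ((\<lambda>t. (t, z)) -` F) \<partial>lborel)"
    by (rule lborel_pair.emeasure_pair_measure_alt2[OF meas(2)])
  also have "\<dots> \<le> (\<integral>\<^sup>+z. emeasure lborel ((\<lambda>u. (u, z)) -` E) \<partial>lborel)"
    by (intro nn_integral_mono section_le)
  also have "\<dots> = emeasure (lborel \<Otimes>\<^sub>M lborel) E"
    by (rule lborel_pair.emeasure_pair_measure_alt2[OF meas(1), symmetric])
  also have "\<dots> = (\<integral>\<^sup>+u. emeasure lborel (Pair u -` E) \<partial>lborel)"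
    by (rule lborel.emeasure_pair_measure_alt[OF meas(1)])
  also have "\<dots> = (\<integral>\<^sup>+u. emeasure lborel (Lq_slice q K L u) * indicator {0..1} u \<partial>lborel)"
    by (intro nn_integral_cong) (auto simp: E_def indicator_def vimage_def)
  finally show ?thesis .
qed

section \<open>Symmetric bodies and the Beta integral\<close>

text \<open>With \<open>-K = K + c\<close> the set \<open>a K + b (-K)\<close> is \<open>a K + b K + b c = (a + b) K + b c\<close>.\<close>

lemma emeasure_Lq_slice_symmetric:
  fixes K :: "'a::euclidean_space set"
  assumes K: "convex_body K" and sym: "uminus ` K = (\<lambda>y. y + c) ` K"
  shows "emeasure lborel (Lq_slice q K (uminus ` K) u)
    = ennreal ((u powr (1 / q) + (1 - u) powr (1 / q)) ^ DIM('a)) * emeasure lborel K"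
proof -
  define a b where "a = u powr (1 / q)" and "b = (1 - u) powr (1 / q)"
  have ab: "0 \<le> a" "0 \<le> b" by (auto simp: a_def b_def)
  have "Lq_slice q K (uminus ` K) u = (\<lambda>x. (a + b) *\<^sub>R x + b *\<^sub>R c) ` K" (is "_ = ?R")
  proof
    show "Lq_slice q K (uminus ` K) u \<subseteq> ?R"
    proof
      fix z assume "z \<in> Lq_slice q K (uminus ` K) u"
      then obtain x y where xy: "x \<in> K" "y \<in> K" "z = a *\<^sub>R x + b *\<^sub>R (y + c)"
        unfolding Lq_slice_def sym a_def b_def by auto
      obtain w where "w \<in> K" "(a + b) *\<^sub>R w = a *\<^sub>R x + b *\<^sub>R y"
        using convex_combine_multiples[OF _ xy(1,2) ab] K by (auto simp: convex_body_def)
      with xy show "z \<in> ?R" by (force simp: scaleR_add_right)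
    qed
  next
    show "?R \<subseteq> Lq_slice q K (uminus ` K) u"
      unfolding Lq_slice_def sym a_def[symmetric] b_def[symmetric]
      by (force simp: algebra_simps)
  qed
  moreover have "compact ?R"
    using K by (intro compact_continuous_image continuous_intros) (auto simp: convex_body_def)
  moreover have "compact K" using K by (simp add: convex_body_def)
  ultimately show ?thesis
    using emeasure_lebesgue_affine[of "a + b" "b *\<^sub>R c" K] ab
    by (simp add: emeasure_completion borel_compact a_def b_def ennreal_power)
qed

lemma real_binomial_inverse_conv_Beta:
  assumes "0 \<le> y" "y \<le> x"
  shows "inverse (real_binomial x y) = (x + 1) * Beta (y + 1) (x - y + 1)"
proof -
  have "Gamma (x + 1 + 1) = (x + 1) * Gamma (x + 1)"
    using assms by (intro Gamma_plus1) (auto dest: nonpos_Ints_nonpos)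
  moreover have "Gamma (x + 1) > 0" using assms by (intro Gamma_real_pos) auto
  moreover have "x + 1 \<noteq> 0" "y + 1 + (x - y + 1) = x + 1 + 1" using assms by auto
  ultimately show ?thesis
    by (simp add: real_binomial_def Beta_def)
qed

text \<open>In the binomial expansion the \<open>k\<close>-th term integrates to a Beta value with arguments
  \<open>k/q + 1\<close> and \<open>(n-k)/q + 1\<close>. These arguments sum to \<open>n/q + 2\<close>, one more than in the binomial
  coefficient, hence the factor \<open>n/q + 1\<close>.\<close>

lemma has_integral_sum_of_roots_power:
  fixes q :: real
  assumes q: "1 \<le> q"
  shows "((\<lambda>u. (u powr (1 / q) + (1 - u) powr (1 / q)) ^ n) has_integral
    (\<Sum>k = 0..n. real (n choose k) * inverse (real_binomial (real n / q) (real k / q)))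
      / (real n / q + 1)) {0..1}"
proof -
  have pos: "0 < real n / q + 1" using q by (simp add: add_nonneg_pos)
  have Beta_sum: "((\<lambda>u. \<Sum>k = 0..n. real (n choose k) * (u powr (real k / q) * (1 - u) powr (real (n - k) / q)))
      has_integral (\<Sum>k = 0..n. real (n choose k) * Beta (real k / q + 1) (real (n - k) / q + 1))) {0..1}"
    using has_integral_Beta_real[of "real k / q + 1" "real (n - k) / q + 1" for k] q
    by (intro has_integral_sum has_integral_mult_right) (auto simp: add_nonneg_pos simp del: of_nat_diff)
  have coeffs: "(\<Sum>k = 0..n. real (n choose k) * Beta (real k / q + 1) (real (n - k) / q + 1))
      = (\<Sum>k = 0..n. real (n choose k) * inverse (real_binomial (real n / q) (real k / q)))
        / (real n / q + 1)"
    unfolding sum_divide_distrib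
  proof (intro sum.cong refl)
    fix k assume "k \<in> {0..n}"
    then have k: "0 \<le> real k / q" "real k / q \<le> real n / q"
      and d: "real (n - k) / q = real n / q - real k / q"
      using q by (auto simp: divide_right_mono of_nat_diff diff_divide_distrib)
    show "real (n choose k) * Beta (real k / q + 1) (real (n - k) / q + 1)
        = real (n choose k) * inverse (real_binomial (real n / q) (real k / q)) / (real n / q + 1)"
      using pos unfolding real_binomial_inverse_conv_Beta[OF k] d by simp
  qed
  have expand: "(\<Sum>k = 0..n. real (n choose k) * (u powr (real k / q) * (1 - u) powr (real (n - k) / q)))
      = (u powr (1 / q) + (1 - u) powr (1 / q)) ^ n" if "u \<in> {0<..<1}" for u
  proof -
    have "u powr (real k / q) = (u powr (1 / q)) ^ k" "(1 - u) powr (real k / q) = ((1 - u) powr (1 / q)) ^ k"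
      for k using that by (simp_all add: powr_powr flip: powr_realpow)
    then show ?thesis
      by (simp add: binomial_ring atMost_atLeast0 mult.assoc del: of_nat_diff)
  qed
  \<comment> \<open>At an endpoint the term with exponent \<open>0\<close> breaks the expansion, because \<open>0 powr 0 = 0\<close>;
    passing to the open interval discards the endpoints.\<close>
  show ?thesis
    using Beta_sum unfolding has_integral_Icc_iff_Ioo coeffs
    by (rule has_integral_eq[rotated]) (rule expand)
qed

theorem proposition5p3:
  fixes K :: "(real ^ 'n) set" and p :: ereal and q :: real
  assumes "CARD('n) \<ge> 2"
    and "1 < p" and "1 \<le> q" and "1 / p + 1 / ereal q = 1"
    and "convex_body K" and "0 \<in> K"
    and "has_center_of_symmetry K"
  shows "measure lebesgue (Lp_sum p K (uminus ` K))
    \<le> (\<Sum>k = 0..CARD('n). real (CARD('n) choose k)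
          * inverse (real_binomial (real CARD('n) / q) (real k / q)))
      * measure lebesgue K"
proof -
  let ?L = "uminus ` K" and ?U = "Lq_union q K (uminus ` K)"
  define S where "S = (\<Sum>k = 0..CARD('n). real (CARD('n) choose k)
          * inverse (real_binomial (real CARD('n) / q) (real k / q)))"
  define d where "d = real CARD('n) / q + 1"
  have d: "0 < d" using \<open>1 \<le> q\<close> by (simp add: d_def add_nonneg_pos)
  obtain c where c: "?L = (\<lambda>y. y + c) ` K"
    using \<open>has_center_of_symmetry K\<close> by (auto simp: has_center_of_symmetry_def)
  have L: "convex_body ?L" "0 \<in> ?L"
    using \<open>convex_body K\<close> \<open>0 \<in> K\<close>
    by (auto simp: convex_body_def compact_negations convex_negations)
  have cU: "compact ?U" and cK: "compact K" and cM: "compact (Lp_sum p K ?L)"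
    using convex_body_Lq_union[OF \<open>1 \<le> q\<close> \<open>convex_body K\<close> L(1)] \<open>convex_body K\<close>
      convex_body_Lp_sum[OF \<open>1 < p\<close> \<open>convex_body K\<close> \<open>0 \<in> K\<close> L]
    by (auto simp: convex_body_def)
  have int: "(\<integral>\<^sup>+u. ennreal ((u powr (1 / q) + (1 - u) powr (1 / q)) ^ CARD('n)) * indicator {0..1} u
      \<partial>lborel) = ennreal (S / d)"
    using has_integral_sum_of_roots_power[OF \<open>1 \<le> q\<close>] unfolding S_def d_def
    by (intro nn_integral_has_integral_lebesgue') auto
  have "((\<lambda>u. (u powr (1 / q) + (1 - u) powr (1 / q)) ^ CARD('n)) has_integral S / d) {0..1}"
    using has_integral_sum_of_roots_power[OF \<open>1 \<le> q\<close>] unfolding S_def d_def .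
  then have S: "0 \<le> S / d"
    by (rule has_integral_nonneg) auto
  have "ennreal (1 / d) * emeasure lborel ?U
      \<le> (\<integral>\<^sup>+u. ennreal ((u powr (1 / q) + (1 - u) powr (1 / q)) ^ CARD('n)) * indicator {0..1} u
           * emeasure lborel K \<partial>lborel)"
    using volume_Lq_union_le_integral_slices[OF \<open>1 \<le> q\<close> \<open>convex_body K\<close> \<open>0 \<in> K\<close> L]
    by (simp add: d_def emeasure_Lq_slice_symmetric[OF \<open>convex_body K\<close> c] mult_ac)
  also have "\<dots> = ennreal (S / d) * emeasure lborel K"
    unfolding int[symmetric] by (rule nn_integral_multc) simp
  finally have "ennreal (1 / d * measure lborel ?U) \<le> ennreal (S / d * measure lborel K)"
    using S d emeasure_eq_ennreal_measure[of lborel ?U] emeasure_eq_ennreal_measure[of lborel K]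
      emeasure_compact_finite[OF cU] emeasure_compact_finite[OF cK]
    by (simp add: ennreal_mult less_top del: times_divide_eq_left times_divide_eq_right)
  then have "measure lborel ?U \<le> S * measure lborel K"
    using S d by (simp add: field_simps)
  moreover have "measure lebesgue (Lp_sum p K ?L) \<le> measure lebesgue ?U"
    using Lp_sum_subset_Lq_union[OF assms(2,3,4,5,6) L] cU cM
    by (intro measure_mono_fmeasurable) (auto simp: lmeasurable_compact fmeasurableD)
  ultimately show ?thesis
    using cU cK unfolding S_def by (simp add: measure_completion borel_compact)
qed

end
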